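(* Let $G$ be a graph of order $v$ with average vertex degree $D$, and let $n<v$ be a positive integer. Then \[ N(G,n)\le\left\lfloor\frac{(v-D-1)n}{v-n}\right\rfloor. \]
   Context: All graphs are finite simple graphs. An $n$-coloring of a graph $G$ is a proper vertex coloring using at most $n$ colors. Two colorings $C_1,C_2$ of $G$ are orthogonal if whenever two distinct vertices share a color in $C_1$, they have distinct colors in $C_2$. $N(G,n)$ denotes the maximum size of a set of pairwise orthogonal $n$-colorings of $G$. *)

theory Defs
  imports Complex_Main "HOL-Library.FuncSet" "Graph_Theory.Digraph"
begin

text \<open>
  Finite simple graphs are the locale \<^locale>\<open>graph\<close>: finite, loop-free, symmetric digraphs without
  parallel arcs. Each undirected edge is a pair of opposite arcs, so the degree of a vertex is its
  out-degree.
\<close>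

definition average_degree :: "('a, 'b) pre_digraph \<Rightarrow> real" where
  "average_degree G = (\<Sum>u\<in>verts G. real (out_degree G u)) / real (card (verts G))"

text \<open>
  Colors are drawn from the palette \<open>{..<n}\<close>, not all of which need be used. Colorings are
  extensional, so that colorings differing only outside the vertex set are not counted twice.
\<close>

definition colorings :: "('a, 'b) pre_digraph \<Rightarrow> nat \<Rightarrow> ('a \<Rightarrow> nat) set" where
  "colorings G n =
     {c \<in> verts G \<rightarrow>\<^sub>E {..<n}. \<forall>u\<in>verts G. \<forall>w\<in>verts G. u \<rightarrow>\<^bsub>G\<^esub> w \<longrightarrow> c u \<noteq> c w}"

definition orthogonal_colorings ::
    "('a, 'b) pre_digraph \<Rightarrow> ('a \<Rightarrow> nat) \<Rightarrow> ('a \<Rightarrow> nat) \<Rightarrow> bool" where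
  "orthogonal_colorings G c1 c2 \<longleftrightarrow>
     (\<forall>u\<in>verts G. \<forall>w\<in>verts G. u \<noteq> w \<longrightarrow> c1 u = c1 w \<longrightarrow> c2 u \<noteq> c2 w)"

definition max_orthogonal_colorings :: "('a, 'b) pre_digraph \<Rightarrow> nat \<Rightarrow> nat" where
  "max_orthogonal_colorings G n =
     Max {card S | S. S \<subseteq> colorings G n \<and> pairwise (orthogonal_colorings G) S}"

text \<open>The maximum ranges over a finite nonempty set, hence is attained.\<close>

lemma finite_colorings:
  assumes "finite (verts G)"
  shows "finite (colorings G n)"
proof -
  have "finite (verts G \<rightarrow>\<^sub>E {..<n})"
    using assms by (intro finite_PiE) auto
  then show ?thesis
    by (rule finite_subset[rotated]) (auto simp: colorings_def)
qed

lemma finite_card_orthogonal_families: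
  assumes "finite (verts G)"
  shows "finite {card S | S. S \<subseteq> colorings G n \<and> pairwise (orthogonal_colorings G) S}"
proof -
  have "{card S | S. S \<subseteq> colorings G n \<and> pairwise (orthogonal_colorings G) S}
          \<subseteq> card ` Pow (colorings G n)"
    by auto
  then show ?thesis
    using finite_colorings[OF assms] by (meson finite_Pow_iff finite_imageI finite_subset)
qed

lemma max_orthogonal_colorings_attained:
  assumes "finite (verts G)"
  shows "\<exists>S \<subseteq> colorings G n. pairwise (orthogonal_colorings G) S \<and> finite S
           \<and> card S = max_orthogonal_colorings G n"
proof -
  let ?X = "{card S | S. S \<subseteq> colorings G n \<and> pairwise (orthogonal_colorings G) S}"
  have "card {} \<in> ?X"
    by (intro CollectI exI[of _ "{}"]) auto
  then have "max_orthogonal_colorings G n \<in> ?X"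
    unfolding max_orthogonal_colorings_def
    using finite_card_orthogonal_families[OF assms] by (intro Max_in) auto
  then obtain S where "S \<subseteq> colorings G n" "pairwise (orthogonal_colorings G) S"
    "card S = max_orthogonal_colorings G n"
    by auto
  moreover from this have "finite S"
    using finite_colorings[OF assms] finite_subset by blast
  ultimately show ?thesis
    by blast
qed

end

theory Submission
  imports Defs "HOL-Analysis.Convex"
begin

text \<open>
  Count ordered pairs of distinct vertices. The pairs of adjacent vertices number \<open>v D\<close>. A coloring
  with at most \<open>n\<close> colors has, by Cauchy--Schwarz applied to the sizes of its color classes, at least
  \<open>v\<^sup>2 / n - v\<close> monochromatic pairs. Properness makes these disjoint from the adjacent pairs, and
  orthogonality makes them disjoint for different colorings, so \<open>N\<close> pairwise orthogonal colorings give
  \<open>N (v\<^sup>2 / n - v) + v D \<le> v\<^sup>2 - v\<close>.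
\<close>

lemma card_power2_le_card_collision_pairs:
  assumes "finite V" and "c ` V \<subseteq> {..<n}"
  shows "(card V)\<^sup>2 \<le> n * card {(u, w) \<in> V \<times> V. c u = c w}"
proof -
  define cls where "cls i = {u \<in> V. c u = i}" for i
  have fin: "finite (cls i)" for i
    using assms(1) by (simp add: cls_def)
  have "V = (\<Union>i<n. cls i)"
    using assms(2) by (auto simp: cls_def)
  moreover have "card (\<Union>i<n. cls i) = (\<Sum>i<n. card (cls i))"
    using fin by (intro card_UN_disjoint) (auto simp: cls_def)
  ultimately have V: "card V = (\<Sum>i<n. card (cls i))"
    by simp
  have "{(u, w) \<in> V \<times> V. c u = c w} = (\<Union>i<n. cls i \<times> cls i)"
    using assms(2) by (auto simp: cls_def)
  moreover have "card (\<Union>i<n. cls i \<times> cls i) = (\<Sum>i<n. card (cls i \<times> cls i))"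
    using fin by (intro card_UN_disjoint) (auto simp: cls_def)
  ultimately have P: "card {(u, w) \<in> V \<times> V. c u = c w} = (\<Sum>i<n. (card (cls i))\<^sup>2)"
    by (simp add: card_cartesian_product power2_eq_square)
  have "(\<Sum>i<n. real (card (cls i)))\<^sup>2 \<le> (\<Sum>i<n. (real (card (cls i)))\<^sup>2) * n"
    using sum_squared_le_sum_of_squares[of "\<lambda>i. real (card (cls i))" "{..<n}"] by simp
  then have "real ((card V)\<^sup>2) \<le> real (n * card {(u, w) \<in> V \<times> V. c u = c w})"
    unfolding V P by (simp add: mult.commute)
  then show ?thesis
    by (simp only: of_nat_le_iff)
qed

text \<open>Pairs are ordered to match \<open>arcs_ends G\<close>, where each undirected edge
  appears in both directions.\<close>

definition mono_pairs :: "'a set \<Rightarrow> ('a \<Rightarrow> 'c) \<Rightarrow> ('a \<times> 'a) set" where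
  "mono_pairs V c = {(u, w) \<in> V \<times> V. u \<noteq> w \<and> c u = c w}"

definition diag :: "'a set \<Rightarrow> ('a \<times> 'a) set" where
  "diag V = (\<lambda>u. (u, u)) ` V"

lemma card_mono_pairs:
  assumes "finite V"
  shows "card {(u, w) \<in> V \<times> V. c u = c w} = card (mono_pairs V c) + card V"
proof -
  have "finite (mono_pairs V c)"
    by (rule finite_subset[of _ "V \<times> V"]) (auto simp: mono_pairs_def assms)
  moreover have "{(u, w) \<in> V \<times> V. c u = c w} = mono_pairs V c \<union> diag V"
    by (auto simp: mono_pairs_def diag_def)
  moreover have "card (diag V) = card V"
    unfolding diag_def by (intro card_image inj_onI) simp
  moreover have "mono_pairs V c \<inter> diag V = {}"
    by (auto simp: mono_pairs_def diag_def)
  ultimately show ?thesis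
    using assms by (simp add: card_Un_disjoint diag_def)
qed

lemma (in fin_digraph) sum_out_degree:
  "(\<Sum>u\<in>verts G. out_degree G u) = card (arcs G)"
proof -
  have "arcs G = (\<Union>u\<in>verts G. out_arcs G u)"
    by auto
  moreover have "card (\<Union>u\<in>verts G. out_arcs G u) = (\<Sum>u\<in>verts G. card (out_arcs G u))"
    by (intro card_UN_disjoint) auto
  ultimately show ?thesis
    by (simp add: out_degree_def)
qed

text \<open>Without parallel arcs an arc is determined by its ends, so arcs can be counted as pairs
  of vertices.\<close>

lemma (in nomulti_digraph) card_arcs_ends: "card (arcs_ends G) = card (arcs G)"
  unfolding arcs_ends_def by (rule card_image) (rule inj_on_arc_to_ends)

text \<open>The three summands count mutually disjoint sets of pairs of vertices. The last one is
  the diagonal, kept on the left to avoid subtraction on natural numbers.\<close>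

lemma (in digraph) orthogonal_colorings_pair_count:
  assumes S: "S \<subseteq> colorings G n" and orth: "pairwise (orthogonal_colorings G) S"
  shows "(\<Sum>c\<in>S. card (mono_pairs (verts G) c)) + card (arcs G) + card (verts G)
           \<le> (card (verts G))\<^sup>2"
proof -
  let ?V = "verts G"
  let ?M = "\<Union>c\<in>S. mono_pairs ?V c"
  have finS: "finite S"
    using S finite_colorings[OF finite_verts] finite_subset by blast
  have sub: "mono_pairs ?V c \<subseteq> ?V \<times> ?V" for c :: "'a \<Rightarrow> nat"
    by (auto simp: mono_pairs_def)
  have fin: "finite (mono_pairs ?V c)" for c :: "'a \<Rightarrow> nat"
    by (rule finite_subset[OF sub]) simp
  have arcs_sub: "arcs_ends G \<subseteq> ?V \<times> ?V"
    by (auto simp: arcs_ends_def arc_to_ends_def)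
  have fin_arcs: "finite (arcs_ends G)"
    by (rule finite_subset[OF arcs_sub]) simp
  \<comment> \<open>A common pair would consist of distinct vertices sharing a color in both
    colorings.\<close>
  have disj: "mono_pairs ?V c \<inter> mono_pairs ?V c' = {}" if "c \<in> S" "c' \<in> S" "c \<noteq> c'" for c c'
    using pairwiseD[OF orth that] by (auto simp: mono_pairs_def orthogonal_colorings_def)
  have proper: "mono_pairs ?V c \<inter> arcs_ends G = {}" if "c \<in> S" for c
    using S that by (auto simp: mono_pairs_def colorings_def)
  have loopless: "arcs_ends G \<inter> diag ?V = {}"
    by (auto simp: diag_def dest: adj_not_same)
  have "card ?M = (\<Sum>c\<in>S. card (mono_pairs ?V c))"
    using finS fin disj by (intro card_UN_disjoint) blast+
  moreover have "card (?M \<union> arcs_ends G) = card ?M + card (arcs_ends G)"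
    using finS fin fin_arcs proper by (intro card_Un_disjoint) blast+
  moreover have "card ((?M \<union> arcs_ends G) \<union> diag ?V) = card (?M \<union> arcs_ends G) + card (diag ?V)"
    using finS fin fin_arcs loopless
    by (intro card_Un_disjoint) (auto simp: mono_pairs_def diag_def)
  moreover have "card (diag ?V) = card ?V"
    unfolding diag_def by (intro card_image inj_onI) simp
  moreover have "card ((?M \<union> arcs_ends G) \<union> diag ?V) \<le> card (?V \<times> ?V)"
    using sub arcs_sub by (intro card_mono) (auto simp: diag_def)
  ultimately show ?thesis
    by (simp add: card_arcs_ends card_cartesian_product power2_eq_square)
qed

theorem theorem1p3:
  fixes G :: "('a, 'b) pre_digraph" and v n :: nat and D :: real
  assumes "graph G"
    and "v = card (verts G)"
    and "D = average_degree G"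
    and "0 < n" and "n < v"
  shows "int (max_orthogonal_colorings G n)
           \<le> \<lfloor>(real v - D - 1) * real n / (real v - real n)\<rfloor>"
proof -
  interpret graph G
    by fact
  obtain S where S: "S \<subseteq> colorings G n" "pairwise (orthogonal_colorings G) S"
    and N: "card S = max_orthogonal_colorings G n"
    using max_orthogonal_colorings_attained[OF finite_verts] by blast
  have "v > 0" and "verts G \<noteq> {}"
    using assms(2,5) by auto
  \<comment> \<open>Each arc is counted once, at its tail; a nonempty vertex set lets the
    denominator of the average cancel.\<close>
  have D: "real v * D = real (card (arcs G))"
    using \<open>verts G \<noteq> {}\<close> unfolding assms(2,3) average_degree_def
    by (simp add: sum_out_degree flip: of_nat_sum)
  have mono: "(real v)\<^sup>2 / n - v \<le> real (card (mono_pairs (verts G) c))" if "c \<in> S" for c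
  proof -
    have "c ` verts G \<subseteq> {..<n}"
      using that S by (auto simp: colorings_def)
    from card_power2_le_card_collision_pairs[OF finite_verts this]
    have "v\<^sup>2 \<le> n * (card (mono_pairs (verts G) c) + v)"
      unfolding card_mono_pairs[OF finite_verts] by (simp flip: assms(2))
    then have "(real v)\<^sup>2 \<le> real n * (real (card (mono_pairs (verts G) c)) + real v)"
      using of_nat_mono[where 'a = real] by fastforce
    then show ?thesis
      using \<open>0 < n\<close> by (simp add: field_simps)
  qed
  have "card S * ((real v)\<^sup>2 / n - v) \<le> (\<Sum>c\<in>S. real (card (mono_pairs (verts G) c)))"
    using sum_mono[OF mono] by simp
  moreover have "(\<Sum>c\<in>S. real (card (mono_pairs (verts G) c))) + v * D + v \<le> (real v)\<^sup>2"
    using of_nat_mono[OF orthogonal_colorings_pair_count[OF S], where 'a = real]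
    by (simp add: D flip: assms(2))
  ultimately have "card S * ((real v)\<^sup>2 / n - v) + v * D + v \<le> (real v)\<^sup>2"
    by linarith
  \<comment> \<open>Every term carries a factor \<open>v\<close>, which is isolated here so that it
    can be cancelled.\<close>
  then have "real v * (card S * (real v / n - 1) + D + 1) \<le> real v * real v"
    by (simp add: algebra_simps power2_eq_square)
  then have "card S * (real v / n - 1) \<le> v - D - 1"
    using \<open>v > 0\<close> by simp
  then have "card S * (real v - n) \<le> (v - D - 1) * n"
    using \<open>0 < n\<close> by (simp add: field_simps)
  \<comment> \<open>As \<open>n < v\<close>, the divisor is positive and the inequality keeps its
    direction.\<close>
  then have "real (card S) \<le> (real v - D - 1) * real n / (real v - real n)"
    using \<open>n < v\<close> by (simp add: pos_le_divide_eq)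
  \<comment> \<open>The left side is an integer, so the real bound passes to the floor.\<close>
  then show ?thesis
    unfolding N by (simp add: le_floor_iff)
qed

end
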